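(* Let $1\le k\le n$ be integers, let $\alpha\in(0,1)$, and let $F$ be a distribution function on $\mathbb{R}$. Suppose that $X_1,\ldots,X_n$ are independent and that, under the global null hypothesis $H_0$, $X_i\sim F$ for each $i$. Put $$\alpha^{\star}=\frac{1}{e}\cdot\alpha^{1/k}.$$ Then $$\mathbb{P}\left(X_i>F^{-1}\left(1-\frac{k\alpha^{\star}}{n}\right)\text{ for at least }k\text{ indices } i\in\{1,\ldots,n\}\;\Big|\;H_0\right)\le\alpha .$$
   Context: $F^{-1}(p)=\inf\{x\in\mathbb{R}:F(x)\ge p\}$ is the quantile function. The notation $\mathbb{P}(\cdot\mid H_0)$ means probability computed under the global null hypothesis (all means are zero), under which each $X_i$ has distribution $F$; it is not a conditional probability. *)

theory Defs
  imports "HOL-Probability.Probability"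
begin

definition distribution_function :: "(real \<Rightarrow> real) \<Rightarrow> bool" where
  "distribution_function F \<longleftrightarrow>
     mono F \<and> (\<forall>x. continuous (at_right x) F) \<and>
     (F \<longlongrightarrow> 0) at_bot \<and> (F \<longlongrightarrow> 1) at_top"

(* The infimum is the real one, hence meaningful only when the set is nonempty and
   bounded below. For a distribution function this is the case whenever 0 < p < 1. *)
definition quantile :: "(real \<Rightarrow> real) \<Rightarrow> real \<Rightarrow> real" where
  "quantile F p = Inf {x. F x \<ge> p}"

definition alpha_star :: "nat \<Rightarrow> real \<Rightarrow> real" where
  "alpha_star k \<alpha> = 1 / exp 1 * \<alpha> powr (1 / real k)"

end

theory Submission
  imports Defs
begin

text \<open>If at least k of the events \<open>X i > q\<close> occur, then k of them indexed by some k-subset occur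
  simultaneously. With \<open>p = k * \<alpha>\<^sup>\<star> / n\<close>, right continuity of F bounds the probability of each single
  event by p, so independence and a union bound over the k-subsets give
  \<open>(n choose k) * p ^ k \<le> n ^ k / k! * p ^ k = k ^ k / k! * exp (- k) * \<alpha> \<le> \<alpha>\<close>.\<close>

text \<open>The term of index k in the exponential series of \<open>exp (real k)\<close> is at most
  the whole sum, since all terms are nonnegative.\<close>

lemma power_self_le_fact_mult_exp: "real k ^ k \<le> fact k * exp (real k)"
proof -
  have s: "(\<lambda>j. real k ^ j /\<^sub>R fact j) sums exp (real k)"
    by (rule exp_converges)
  have "real k ^ k /\<^sub>R fact k \<le> exp (real k)"
    using sum_le_suminf[OF sums_summable[OF s], of "{k}"] sums_unique[OF s] by simp
  then show ?thesis by (simp add: field_simps)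
qed

text \<open>By monotonicity F is at least p everywhere to the right of the infimum; right continuity
  carries the bound to the infimum itself.\<close>

lemma distribution_function_quantile_ge:
  assumes "distribution_function F" "p < 1"
  shows "p \<le> F (quantile F p)"
proof -
  have mono: "mono F" and cont: "\<And>x. continuous (at_right x) F"
    and top: "(F \<longlongrightarrow> 1) at_top"
    using assms(1) by (auto simp: distribution_function_def)
  define A where "A = {x. F x \<ge> p}"
  obtain x where "p < F x"
    using eventually_happens[OF order_tendstoD(1)[OF top \<open>p < 1\<close>]] by auto
  then have ne: "A \<noteq> {}" by (auto simp: A_def intro!: exI[of _ x])
  have above: "F x \<ge> p" if "Inf A < x" for x
  proof -
    \<comment> \<open>If no element of \<open>A\<close> were below x, then x would be a lower bound
      and \<open>Inf A\<close> at least x. This also covers an \<open>A\<close> unbounded below,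
      which can occur for p \<le> 0.\<close>
    obtain y where "y \<in> A" "y < x" using cInf_lessD[OF ne \<open>Inf A < x\<close>] by blast
    then show ?thesis using monoD[OF mono, of y x] by (auto simp: A_def)
  qed
  have "(F \<longlongrightarrow> F (Inf A)) (at_right (Inf A))"
    using cont by (simp add: continuous_within)
  moreover have "eventually (\<lambda>x. p \<le> F x) (at_right (Inf A))"
    using above by (auto simp: eventually_at_filter)
  ultimately have "p \<le> F (Inf A)"
    by (intro tendsto_lowerbound) auto
  then show ?thesis by (simp add: quantile_def A_def)
qed

context prob_space
begin

lemma prob_gt_eq_one_minus_cdf:
  assumes [measurable]: "random_variable borel X"
  shows "prob (X -` {x<..} \<inter> space M) = 1 - cdf (distr M borel X) (x :: real)"
proof -
  interpret D: real_distribution "distr M borel X" by (rule real_distribution_distr) simp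
  have "prob (X -` {x<..} \<inter> space M) = D.prob (space (distr M borel X) - {..x})"
    by (subst measure_distr) (auto intro!: arg_cong[where f=prob])
  also have "\<dots> = 1 - cdf (distr M borel X) x"
    by (subst D.prob_compl) (auto simp: cdf_def)
  finally show ?thesis .
qed

lemma prob_card_ge_le_binomial_mult_power:
  fixes X :: "'i \<Rightarrow> 'a \<Rightarrow> 'b" and A :: "'i \<Rightarrow> 'b set"
  assumes indep: "indep_vars N X I" and I: "finite I" and k: "1 \<le> k"
    and A: "\<And>i. i \<in> I \<Longrightarrow> A i \<in> sets (N i)"
    and p: "\<And>i. i \<in> I \<Longrightarrow> prob (X i -` A i \<inter> space M) \<le> p"
  shows "prob {\<omega> \<in> space M. k \<le> card {i \<in> I. X i \<omega> \<in> A i}} \<le> real (card I choose k) * p ^ k"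
proof -
  define E where "E i = X i -` A i \<inter> space M" for i
  define K where "K = {S. S \<subseteq> I \<and> card S = k}"
  have finK: "finite K" using I by (simp add: K_def)
  have E: "E i \<in> events" if "i \<in> I" for i
    using indep A that unfolding E_def indep_vars_def2 by (auto intro: measurable_sets)
  \<comment> \<open>Nonemptiness comes from 1 \<le> k. It makes the intersection over S a genuine
    event and lets independence be applied to S.\<close>
  have S: "S \<subseteq> I" "finite S" "S \<noteq> {}" "card S = k" if "S \<in> K" for S
    using that I k by (auto simp: K_def intro: finite_subset)
  have EK: "(\<Inter>i\<in>S. E i) \<in> events" if "S \<in> K" for S
    using S[OF that] E by (intro sets.finite_INT) auto
  have "prob {\<omega> \<in> space M. k \<le> card {i \<in> I. X i \<omega> \<in> A i}} \<le> prob (\<Union>S\<in>K. \<Inter>i\<in>S. E i)"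
  proof (rule finite_measure_mono)
    show "{\<omega> \<in> space M. k \<le> card {i \<in> I. X i \<omega> \<in> A i}} \<subseteq> (\<Union>S\<in>K. \<Inter>i\<in>S. E i)"
    proof
      fix \<omega> assume \<omega>: "\<omega> \<in> {\<omega> \<in> space M. k \<le> card {i \<in> I. X i \<omega> \<in> A i}}"
      \<comment> \<open>Any k of the indices that are hit will do: \<omega> lies in the intersection
        belonging to that subset.\<close>
      then obtain S where "S \<subseteq> {i \<in> I. X i \<omega> \<in> A i}" "card S = k"
        using obtain_subset_with_card_n by blast
      then show "\<omega> \<in> (\<Union>S\<in>K. \<Inter>i\<in>S. E i)"
        using \<omega> by (intro UN_I[of S]) (auto simp: K_def E_def)
    qed
  qed (use EK finK in auto)
  also have "\<dots> \<le> (\<Sum>S\<in>K. prob (\<Inter>i\<in>S. E i))"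
    using finK EK by (intro measure_UNION_le) auto
  also have "\<dots> \<le> (\<Sum>S\<in>K. p ^ k)"
  proof (rule sum_mono)
    fix S assume SK: "S \<in> K"
    have "prob (\<Inter>i\<in>S. E i) = (\<Prod>i\<in>S. prob (E i))"
      unfolding E_def using S[OF SK] A by (intro indep_varsD[OF indep]) auto
    also have "\<dots> \<le> (\<Prod>i\<in>S. p)"
      using S[OF SK] p by (intro prod_mono) (auto simp: E_def)
    finally show "prob (\<Inter>i\<in>S. E i) \<le> p ^ k" using S[OF SK] by simp
  qed
  also have "\<dots> = real (card I choose k) * p ^ k"
    using n_subsets[OF I, of k] by (simp add: K_def)
  finally show ?thesis .
qed

end

text \<open>This is where the form of \<open>alpha_star\<close> pays off: its k-th power turns the
  root back into \<alpha> and 1/e into a factor that offsets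
  \<open>real k ^ k / fact k\<close>.\<close>

lemma binomial_mult_alpha_star_power_le:
  assumes "1 \<le> k" "1 \<le> n" "0 < \<alpha>"
  shows "real (n choose k) * (real k * alpha_star k \<alpha> / real n) ^ k \<le> \<alpha>"
proof -
  have root: "(\<alpha> powr (1 / real k)) ^ k = \<alpha>"
    using assms by (simp add: powr_power)
  have star: "alpha_star k \<alpha> ^ k = \<alpha> / exp (real k)"
    by (simp add: alpha_star_def power_divide root exp_of_nat_mult[symmetric] power_mult_distrib)
  \<comment> \<open>The left side is the falling factorial n (n - 1) ... (n - k + 1), whose k
    factors are at most n when k \<le> n; otherwise it is 0.\<close>
  have binom: "real (n choose k) * fact k \<le> real n ^ k"
    using of_nat_mono[OF binomial_fact_pow[of n k], where 'a = real] by simp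
  have "real (n choose k) * (real k * alpha_star k \<alpha> / real n) ^ k
      = real (n choose k) * (real k ^ k * \<alpha>) / (exp (real k) * real n ^ k)"
    by (simp add: power_mult_distrib power_divide star)
  also have "\<dots> \<le> real (n choose k) * (fact k * exp (real k) * \<alpha>) / (exp (real k) * real n ^ k)"
    using assms power_self_le_fact_mult_exp[of k]
    by (intro divide_right_mono mult_left_mono mult_right_mono) auto
  also have "\<dots> = real (n choose k) * fact k / real n ^ k * \<alpha>"
    by simp
  also have "\<dots> \<le> 1 * \<alpha>"
    using assms binom by (intro mult_right_mono) auto
  finally show ?thesis by simp
qed

theorem theorem3p4:
  fixes M :: "'a measure" and X :: "nat \<Rightarrow> 'a \<Rightarrow> real"
    and F :: "real \<Rightarrow> real" and k n :: nat and \<alpha> :: real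
  assumes "1 \<le> k" and "k \<le> n"
    and "0 < \<alpha>" and "\<alpha> < 1"
    and "distribution_function F"
    and "prob_space M"
    and "prob_space.indep_vars M (\<lambda>_. borel) X {1..n}"
    and "\<forall>i\<in>{1..n}. cdf (distr M borel (X i)) = F"
  shows "measure M {\<omega> \<in> space M.
           card {i \<in> {1..n}. X i \<omega> > quantile F (1 - real k * alpha_star k \<alpha> / real n)} \<ge> k} \<le> \<alpha>"
proof -
  interpret prob_space M by fact
  define p where "p = real k * alpha_star k \<alpha> / real n"
  define q where "q = quantile F (1 - p)"
  \<comment> \<open>The aim is 0 < p < 1, so that the level 1 - p is one where the quantile is a
    genuine infimum. Strictness in p < 1 comes from the factor 1/e.\<close>
  have "\<alpha> powr (1 / real k) \<le> 1"
    using assms by (simp add: powr_le1)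
  moreover have "1 < exp (1 :: real)" by simp
  ultimately have star: "0 < alpha_star k \<alpha>" "alpha_star k \<alpha> < 1"
    using assms by (auto simp: alpha_star_def divide_simps simp del: one_less_exp_iff)
  have "real k * alpha_star k \<alpha> < real k * 1"
    using star assms by (intro mult_strict_left_mono) auto
  also have "\<dots> \<le> real n" using assms by simp
  finally have p: "0 < p" "p < 1"
    using star assms by (auto simp: p_def divide_simps)
  \<comment> \<open>Hence each tail probability 1 - F q is at most p, even if F jumps at q.\<close>
  have "1 - p \<le> F q"
    unfolding q_def using assms p by (intro distribution_function_quantile_ge) auto
  moreover have "prob (X i -` {q<..} \<inter> space M) = 1 - F q" if "i \<in> {1..n}" for i
    using assms that prob_gt_eq_one_minus_cdf[of "X i" q] by (auto simp: indep_vars_def2)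
  ultimately have "prob {\<omega> \<in> space M. k \<le> card {i \<in> {1..n}. X i \<omega> \<in> {q<..}}}
      \<le> real (card {1..n} choose k) * p ^ k"
    using assms by (intro prob_card_ge_le_binomial_mult_power) auto
  also have "\<dots> \<le> \<alpha>"
    using assms binomial_mult_alpha_star_power_le[of k n \<alpha>] by (simp add: p_def)
  finally show ?thesis by (simp add: q_def p_def)
qed

end
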